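(* Let $\Theta=(\alpha,\beta,\gamma)\in S_n\times S_n\times S_n$ be such that $\Delta(\Theta)>0$, and let $t\in\{1,\dots,n\}$ with $\mathbf{l}^\gamma_t>0$. If $r,s\in\{1,\dots,t\}$ satisfy $\mathbf{l}^\alpha_r>0$ and $\mathbf{l}^\beta_s>0$, then $$\sum_{u\in S^\beta_{r,t}} u\cdot\mathbf{l}^\beta_u\le t\cdot\mathbf{l}^\gamma_t\qquad\text{and}\qquad \sum_{u\in S^\alpha_{s,t}} u\cdot\mathbf{l}^\alpha_u\le t\cdot\mathbf{l}^\gamma_t.$$
   Context: Let $N=\{0,1,\dots,n-1\}$ and $S_n$ the symmetric group on $N$. A Latin square of order $n$ is an $n\times n$ array $L=(l_{i,j})$ with entries in $N$ in which each symbol occurs exactly once in each row and column. For $\Theta=(\alpha,\beta,\gamma)\in S_n^3$, $L^\Theta$ is the array with $(i,j)$ entry $\gamma^{-1}(l_{\alpha(i),\beta(j)})$; $\Theta$ is an autotopism of $L$ if $L^\Theta=L$. $\Delta(\Theta)$ is the number of Latin squares of order $n$ having $\Theta$ as an autotopism. For $\delta\in S_n$, $\mathbf{l}^\delta_r$ is the number of cycles of length $r$ in its disjoint cycle decomposition (fixed points are cycles of length 1). For $r,s\in\{1,\dots,n\}$ with $\mathbf{l}^\alpha_r\cdot\mathbf{l}^\beta_s>0$, let $m=\mathrm{lcm}(r,s)$ and define $S^\gamma_{r,s}$ as the set of $t'\in\{1,\dots,m\}$ such that $\mathbf{l}^\gamma_{t'}>0$, $t'$ divides $m$, $t'$ does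 not divide any positive multiple of $r$ smaller than $m$, and $t'$ does not divide any positive multiple of $s$ smaller than $m$. Then define $S^\beta_{r,t}=\{u\in\{1,\dots,n\}:\mathbf{l}^\beta_u>0\text{ and }S^\gamma_{r,u}=\{t\}\}$ and $S^\alpha_{s,t}=\{u\in\{1,\dots,n\}:\mathbf{l}^\alpha_u>0\text{ and }S^\gamma_{u,s}=\{t\}\}$. *)

theory Defs
  imports "HOL-Library.FuncSet" "HOL-Combinatorics.Orbits"
begin

(* An n x n array is an extensional function on {..<n} x {..<n}, so that distinct members of
   latin_squares n really are distinct arrays and can be counted. *)
definition latin_squares :: "nat \<Rightarrow> (nat \<times> nat \<Rightarrow> nat) set" where
  "latin_squares n = {L \<in> {..<n} \<times> {..<n} \<rightarrow>\<^sub>E {..<n}.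
     (\<forall>i<n. \<forall>k<n. \<exists>!j. j < n \<and> L (i, j) = k) \<and>
     (\<forall>j<n. \<forall>k<n. \<exists>!i. i < n \<and> L (i, j) = k)}"

type_synonym perm_triple = "(nat \<Rightarrow> nat) \<times> (nat \<Rightarrow> nat) \<times> (nat \<Rightarrow> nat)"

fun isotope :: "nat \<Rightarrow> perm_triple \<Rightarrow> (nat \<times> nat \<Rightarrow> nat) \<Rightarrow> (nat \<times> nat \<Rightarrow> nat)" where
  "isotope n (\<alpha>, \<beta>, \<gamma>) L =
     restrict (\<lambda>(i, j). inv \<gamma> (L (\<alpha> i, \<beta> j))) ({..<n} \<times> {..<n})"

definition autotopism :: "nat \<Rightarrow> perm_triple \<Rightarrow> (nat \<times> nat \<Rightarrow> nat) \<Rightarrow> bool" where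
  "autotopism n \<Theta> L \<longleftrightarrow> isotope n \<Theta> L = L"

definition Delta :: "nat \<Rightarrow> perm_triple \<Rightarrow> nat" where
  "Delta n \<Theta> = card {L \<in> latin_squares n. autotopism n \<Theta> L}"

(* The cycles of a permutation of {..<n} are identified with its orbits on {..<n}; a fixed point
   is an orbit of size 1. *)
definition num_cycles :: "nat \<Rightarrow> (nat \<Rightarrow> nat) \<Rightarrow> nat \<Rightarrow> nat" where
  "num_cycles n \<delta> r = card {C \<in> orbit \<delta> ` {..<n}. card C = r}"

(* Meant for r and s that are cycle lengths of \<alpha> and \<beta>, respectively; the value depends only
   on \<gamma>, r and s, so that condition is left to the places where the set is used. *)
definition S_gamma :: "nat \<Rightarrow> (nat \<Rightarrow> nat) \<Rightarrow> nat \<Rightarrow> nat \<Rightarrow> nat set" where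
  "S_gamma n \<gamma> r s = {t' \<in> {1..lcm r s}.
     num_cycles n \<gamma> t' > 0 \<and>
     t' dvd lcm r s \<and>
     (\<forall>k>0. k * r < lcm r s \<longrightarrow> \<not> t' dvd k * r) \<and>
     (\<forall>k>0. k * s < lcm r s \<longrightarrow> \<not> t' dvd k * s)}"

definition S_beta :: "nat \<Rightarrow> (nat \<Rightarrow> nat) \<Rightarrow> (nat \<Rightarrow> nat) \<Rightarrow> nat \<Rightarrow> nat \<Rightarrow> nat set" where
  "S_beta n \<beta> \<gamma> r t = {u \<in> {1..n}. num_cycles n \<beta> u > 0 \<and> S_gamma n \<gamma> r u = {t}}"

definition S_alpha :: "nat \<Rightarrow> (nat \<Rightarrow> nat) \<Rightarrow> (nat \<Rightarrow> nat) \<Rightarrow> nat \<Rightarrow> nat \<Rightarrow> nat set" where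
  "S_alpha n \<alpha> \<gamma> s t = {u \<in> {1..n}. num_cycles n \<alpha> u > 0 \<and> S_gamma n \<gamma> u s = {t}}"

end

(* Fix a point i on an r-cycle of alpha and consider row i. If the column j lies on a u-cycle of
   beta and the symbol in cell (i,j) on a t'-cycle of gamma, then each of the three cycle lengths
   divides the lcm of the other two: a power of the autotopism fixing two coordinates of a triple
   (row, column, symbol) fixes the third. Hence t' lies in S_gamma r u. So the columns j whose
   cycle length u satisfies S_gamma r u = {t} are sent injectively by row i into the symbols on
   t-cycles of gamma. The second inequality is the first one for the transposed square. *)
theory Submission
  imports Defs "HOL-Combinatorics.Cycles"
begin

text \<open>The orbit is the entry set of the list \<open>support p x\<close>, which has length
  \<open>least_power p x\<close> and no repeated entry.\<close>

lemma card_orbit_eq_least_power: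
  assumes "permutation p"
  shows "card (orbit p x) = least_power p x"
proof -
  have "orbit p x = {(p ^^ m) x |m. m < least_power p x}"
    using least_power_of_permutation[OF assms] by (intro orbit_altdef_bounded)
  also have "\<dots> = set (support p x)"
    by auto
  finally show ?thesis
    using distinct_card[OF cycle_of_permutation[OF assms, of x]] by simp
qed

text \<open>Bridge between arithmetic and dynamics: every divisibility by a cycle length below is
  proved by checking that a power of a permutation fixes a point.\<close>

lemma card_orbit_dvd_iff:
  assumes "permutation p"
  shows "card (orbit p x) dvd m \<longleftrightarrow> (p ^^ m) x = x"
  using assms by (simp add: card_orbit_eq_least_power least_power_dvd)

lemma card_orbit_pos:
  assumes "permutation p"
  shows "card (orbit p x) > 0"
  using assms by (simp add: card_orbit_eq_least_power least_power_of_permutation)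

text \<open>The cycles of length \<open>u\<close> are pairwise disjoint and together cover exactly
  the points lying on such cycles, so both sides of the inequality become counts of points.\<close>

lemma mult_num_cycles:
  assumes "p permutes {..<n}"
  shows "u * num_cycles n p u = card {x\<in>{..<n}. card (orbit p x) = u}"
proof -
  have perm: "permutation p"
    using assms by (auto simp: permutation_permutes)
  let ?C = "{C \<in> orbit p ` {..<n}. card C = u}"
  have eq: "\<Union>?C = {x\<in>{..<n}. card (orbit p x) = u}"
  proof (intro equalityI subsetI)
    fix x assume "x \<in> \<Union>?C"
    then obtain y where y: "y < n" "card (orbit p y) = u" "x \<in> orbit p y"
      by auto
    then have "orbit p x = orbit p y"
      using orbit_cyclic_eq3 cyclic_on_orbit'[OF perm] by metis
    with y permutes_orbit_subset[OF assms] show "x \<in> {x\<in>{..<n}. card (orbit p x) = u}"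
      by auto
  qed (use permutation_self_in_orbit[OF perm] in auto)
  have "u * card ?C = card (\<Union>?C)"
  proof (rule card_partition)
    show "finite (\<Union>?C)"
      unfolding eq by simp
    show "A \<inter> B = {}" if "A \<in> ?C" "B \<in> ?C" "A \<noteq> B" for A B
      using that orbit_cyclic_eq3[OF cyclic_on_orbit'[OF perm]] by blast
  qed auto
  then show ?thesis
    unfolding eq num_cycles_def .
qed

lemma sum_mult_num_cycles:
  assumes "p permutes {..<n}" "finite U"
  shows "(\<Sum>u\<in>U. u * num_cycles n p u) = card {x\<in>{..<n}. card (orbit p x) \<in> U}"
proof -
  have "{x\<in>{..<n}. card (orbit p x) \<in> U} = (\<Union>u\<in>U. {x\<in>{..<n}. card (orbit p x) = u})"
    by auto
  also have "card \<dots> = (\<Sum>u\<in>U. card {x\<in>{..<n}. card (orbit p x) = u})"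
    using assms(2) by (intro card_UN_disjoint) auto
  finally show ?thesis
    using assms(1) by (simp add: mult_num_cycles)
qed

lemma num_cycles_posE:
  assumes "num_cycles n p r > 0"
  obtains x where "x < n" "card (orbit p x) = r"
proof -
  have "{C \<in> orbit p ` {..<n}. card C = r} \<noteq> {}"
    using assms unfolding num_cycles_def by (metis card.empty less_irrefl)
  with that show ?thesis
    by auto
qed

lemma num_cycles_pos:
  assumes "x < n"
  shows "num_cycles n p (card (orbit p x)) > 0"
  unfolding num_cycles_def using assms by (subst card_gt_0_iff) auto

text \<open>Only injectivity in each row and column enters the argument; this formulation is symmetric
  in rows and columns.\<close>

locale row_column_injective_autotopism =
  fixes n :: nat and \<alpha> \<beta> \<gamma> :: "nat \<Rightarrow> nat" and M :: "nat \<Rightarrow> nat \<Rightarrow> nat"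
  assumes perms: "\<alpha> permutes {..<n}" "\<beta> permutes {..<n}" "\<gamma> permutes {..<n}"
    and M_less: "i < n \<Longrightarrow> j < n \<Longrightarrow> M i j < n"
    and M_step: "i < n \<Longrightarrow> j < n \<Longrightarrow> M (\<alpha> i) (\<beta> j) = \<gamma> (M i j)"
    and inj_row: "i < n \<Longrightarrow> inj_on (M i) {..<n}"
    and inj_column: "j < n \<Longrightarrow> inj_on (\<lambda>i. M i j) {..<n}"
begin

lemma permutations: "permutation \<alpha>" "permutation \<beta>" "permutation \<gamma>"
  using perms by (auto simp: permutation_permutes)

lemma funpow_less: "i < n \<Longrightarrow> (\<alpha> ^^ m) i < n" "j < n \<Longrightarrow> (\<beta> ^^ m) j < n"
  using permutes_in_image[OF permutes_funpow[OF perms(1)]]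
    permutes_in_image[OF permutes_funpow[OF perms(2)]]
  by simp_all

lemma M_funpow: "i < n \<Longrightarrow> j < n \<Longrightarrow> M ((\<alpha> ^^ m) i) ((\<beta> ^^ m) j) = (\<gamma> ^^ m) (M i j)"
  by (induction m) (simp_all add: M_step funpow_less)

lemma card_orbit_mem_S_gamma:
  assumes ij: "i < n" "j < n"
  shows "card (orbit \<gamma> (M i j)) \<in> S_gamma n \<gamma> (card (orbit \<alpha> i)) (card (orbit \<beta> j))"
proof -
  let ?r = "card (orbit \<alpha> i)" and ?u = "card (orbit \<beta> j)" and ?t = "card (orbit \<gamma> (M i j))"
  note dvd_iff = permutations[THEN card_orbit_dvd_iff]
  \<comment> \<open>Positivity is what turns divisibility of the lcm by \<open>?t\<close> into the
    bound \<open>?t \<le> lcm ?r ?u\<close>.\<close>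
  have pos: "lcm ?r ?u > 0"
    using permutations card_orbit_pos by (metis lcm_pos_nat)
  have symbol: "?t dvd m" if "?r dvd m" "?u dvd m" for m
    using that M_funpow[OF ij, of m] by (simp add: dvd_iff)
  \<comment> \<open>The m-th power fixes row \<open>i\<close> and the symbol, so the columns
    \<open>j\<close> and \<open>(\<beta> ^^ m) j\<close> carry the same symbol in row
    \<open>i\<close>; injectivity of that row identifies them. The dual fact for rows uses column
    \<open>j\<close>.\<close>
  have column: "?u dvd m" if "?r dvd m" "?t dvd m" for m
    using that M_funpow[OF ij, of m] inj_row[OF ij(1)] ij funpow_less
    by (auto simp: dvd_iff inj_on_eq_iff)
  have row: "?r dvd m" if "?u dvd m" "?t dvd m" for m
    using that M_funpow[OF ij, of m] inj_on_eq_iff[OF inj_column[OF ij(2)]] ij funpow_less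
    by (auto simp: dvd_iff)
  \<comment> \<open>If \<open>?t\<close> divided \<open>m\<close>, then \<open>row\<close> or
    \<open>column\<close> would make \<open>m\<close> a common multiple of \<open>?r\<close> and
    \<open>?u\<close>, which a positive number below their lcm cannot be.\<close>
  have not_dvd: "\<not> ?t dvd m" if "0 < m" "m < lcm ?r ?u" "?r dvd m \<or> ?u dvd m" for m
    using that row column lcm_least[of ?r m ?u] dvd_imp_le[of "lcm ?r ?u" m] by fastforce
  have "?t dvd lcm ?r ?u"
    by (rule symbol) auto
  moreover have "?t \<in> {1..lcm ?r ?u}"
    using calculation dvd_imp_le pos card_orbit_pos[OF permutations(3)]
    by (simp add: Suc_le_eq)
  moreover have "num_cycles n \<gamma> ?t > 0"
    using ij M_less by (intro num_cycles_pos)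
  moreover have "\<not> ?t dvd k * ?r" if "0 < k" "k * ?r < lcm ?r ?u" for k
    by (rule not_dvd[OF mult_pos_pos[OF that(1) card_orbit_pos[OF permutations(1)]] that(2)])
      (rule disjI1, rule dvd_triv_right)
  moreover have "\<not> ?t dvd k * ?u" if "0 < k" "k * ?u < lcm ?r ?u" for k
    by (rule not_dvd[OF mult_pos_pos[OF that(1) card_orbit_pos[OF permutations(2)]] that(2)])
      (rule disjI2, rule dvd_triv_right)
  ultimately show ?thesis
    unfolding S_gamma_def by blast
qed

lemma sum_S_beta_le:
  assumes "num_cycles n \<alpha> r > 0"
  shows "(\<Sum>u\<in>S_beta n \<beta> \<gamma> r t. u * num_cycles n \<beta> u) \<le> t * num_cycles n \<gamma> t"
proof -
  obtain i where i: "i < n" "card (orbit \<alpha> i) = r"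
    using assms by (rule num_cycles_posE)
  let ?J = "{j\<in>{..<n}. card (orbit \<beta> j) \<in> S_beta n \<beta> \<gamma> r t}"
  have "finite (S_beta n \<beta> \<gamma> r t)"
    unfolding S_beta_def by simp
  then have "(\<Sum>u\<in>S_beta n \<beta> \<gamma> r t. u * num_cycles n \<beta> u) = card ?J"
    by (rule sum_mult_num_cycles[OF perms(2)])
  also have "\<dots> \<le> card {k\<in>{..<n}. card (orbit \<gamma> k) = t}"
  proof (rule card_inj_on_le)
    show "inj_on (M i) ?J"
      by (rule inj_on_subset[OF inj_row[OF i(1)]]) auto
    show "M i ` ?J \<subseteq> {k\<in>{..<n}. card (orbit \<gamma> k) = t}"
    proof
      fix k assume "k \<in> M i ` ?J"
      then obtain j where j: "j < n" "card (orbit \<beta> j) \<in> S_beta n \<beta> \<gamma> r t" "k = M i j"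
        by auto
      have "card (orbit \<gamma> k) \<in> S_gamma n \<gamma> r (card (orbit \<beta> j))"
        using card_orbit_mem_S_gamma[OF i(1) j(1)] i j by simp
      \<comment> \<open>Membership in \<open>S_beta\<close> makes this \<open>S_gamma\<close> set
        the singleton \<open>{t}\<close>, which forces the symbol's cycle length to be
        \<open>t\<close>.\<close>
      with j M_less[OF i(1) j(1)] show "k \<in> {k\<in>{..<n}. card (orbit \<gamma> k) = t}"
        by (simp add: S_beta_def)
    qed
  qed simp
  also have "\<dots> = t * num_cycles n \<gamma> t"
    by (rule mult_num_cycles[OF perms(3), symmetric])
  finally show ?thesis .
qed

lemma transpose: "row_column_injective_autotopism n \<beta> \<alpha> \<gamma> (\<lambda>i j. M j i)"
  by unfold_locales (use perms M_less M_step inj_row inj_column in auto)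

end

text \<open>Exchanging the two lengths in \<open>S_gamma\<close> keeps the lcm and merely swaps the
  two non-divisibility conditions.\<close>

lemma S_alpha_eq_S_beta: "S_alpha n \<alpha> \<gamma> s t = S_beta n \<alpha> \<gamma> s t"
proof -
  have "S_gamma n \<gamma> u s = S_gamma n \<gamma> s u" for u
    unfolding S_gamma_def lcm.commute[of u s] by auto
  then show ?thesis
    by (simp add: S_alpha_def S_beta_def)
qed

lemma latin_square_autotopism:
  assumes perms: "\<alpha> permutes {..<n}" "\<beta> permutes {..<n}" "\<gamma> permutes {..<n}"
    and L: "L \<in> latin_squares n" and autotopism: "autotopism n (\<alpha>, \<beta>, \<gamma>) L"
  shows "row_column_injective_autotopism n \<alpha> \<beta> \<gamma> (\<lambda>i j. L (i, j))"
proof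
  show less: "L (i, j) < n" if "i < n" "j < n" for i j
    using L that by (force simp: latin_squares_def PiE_iff)
  show "L (\<alpha> i, \<beta> j) = \<gamma> (L (i, j))" if "i < n" "j < n" for i j
  proof -
    have "L (i, j) = isotope n (\<alpha>, \<beta>, \<gamma>) L (i, j)"
      using autotopism by (simp add: autotopism_def)
    also have "\<dots> = inv \<gamma> (L (\<alpha> i, \<beta> j))"
      using that by simp
    finally show ?thesis
      \<comment> \<open>Applying \<open>\<gamma>\<close> to both sides cancels the
        \<open>inv \<gamma>\<close> of the isotope.\<close>
      using permutes_inverses(1)[OF perms(3)] by simp
  qed
  show "inj_on (\<lambda>j. L (i, j)) {..<n}" if "i < n" for i
  proof (rule inj_onI)
    fix j j' assume "j \<in> {..<n}" "j' \<in> {..<n}" "L (i, j) = L (i, j')"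
    \<comment> \<open>The Latin condition is applied to the shared symbol \<open>L (i, j)\<close>,
      which lies in the range of symbols by \<open>less\<close>.\<close>
    moreover from this have "\<exists>!j''. j'' < n \<and> L (i, j'') = L (i, j)"
      using L that less by (simp add: latin_squares_def)
    ultimately show "j = j'"
      by auto
  qed
  show "inj_on (\<lambda>i. L (i, j)) {..<n}" if "j < n" for j
  proof (rule inj_onI)
    fix i i' assume "i \<in> {..<n}" "i' \<in> {..<n}" "L (i, j) = L (i', j)"
    moreover from this have "\<exists>!i''. i'' < n \<and> L (i'', j) = L (i, j)"
      using L that less by (simp add: latin_squares_def)
    ultimately show "i = i'"
      by auto
  qed
qed (use perms in auto)

theorem theorem4:
  fixes n r s t :: nat and \<alpha> \<beta> \<gamma> :: "nat \<Rightarrow> nat"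
  assumes "\<alpha> permutes {..<n}" and "\<beta> permutes {..<n}" and "\<gamma> permutes {..<n}"
    and "Delta n (\<alpha>, \<beta>, \<gamma>) > 0"
    and "t \<in> {1..n}" and "num_cycles n \<gamma> t > 0"
    and "r \<in> {1..t}" and "s \<in> {1..t}"
    and "num_cycles n \<alpha> r > 0" and "num_cycles n \<beta> s > 0"
  shows "(\<Sum>u\<in>S_beta n \<beta> \<gamma> r t. u * num_cycles n \<beta> u) \<le> t * num_cycles n \<gamma> t \<and>
         (\<Sum>u\<in>S_alpha n \<alpha> \<gamma> s t. u * num_cycles n \<alpha> u) \<le> t * num_cycles n \<gamma> t"
proof -
  obtain L where "L \<in> latin_squares n" "autotopism n (\<alpha>, \<beta>, \<gamma>) L"
    using assms(4) unfolding Delta_def by (auto simp: card_gt_0_iff)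
  then interpret row_column_injective_autotopism n \<alpha> \<beta> \<gamma> "\<lambda>i j. L (i, j)"
    by (rule latin_square_autotopism[OF assms(1-3)])
  show ?thesis
    unfolding S_alpha_eq_S_beta
    \<comment> \<open>In the transposed square \<open>\<beta>\<close> acts on the rows, so the fixed
      row is taken from an s-cycle of \<open>\<beta>\<close>.\<close>
    using sum_S_beta_le[OF assms(9)]
      row_column_injective_autotopism.sum_S_beta_le[OF transpose assms(10)]
    by blast
qed

end
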